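(* Let $(\Omega,\mathcal F,\mu,T)$ be an ergodic probability-preserving invertible dynamical system, $c:\Omega\to\,]0,+\infty[$ a measurable function, and let $(S_n)_{n\ge 0}$ be the associated random walk among conductances on $\mathbb Z$ (see context). Suppose $1/c$ is $\mu$-integrable. Then for $\mu$-almost every $\omega\in\Omega$ and for every real $a>0$, the sequence $$\left(\sqrt{2n}\,\max_{x\in B(0,a\sqrt{2n})\cap2\mathbb Z}\frac{\mathbb P_0^\omega[S_{2n}=x]}{\overline c(x)(\omega)}\right)_{n\ge1}$$ is bounded. If, moreover, $\int\overline c\,d\mu=+\infty$, then for $\mu$-almost every $\omega\in\Omega$ and for every real $a>0$, $$\lim_{n\to+\infty}\sqrt{2n}\,\max_{x\in B(0,a\sqrt{2n})\cap2\mathbb Z}\left(\frac{\mathbb P_0^\omega[S_{2n}=x]}{\overline c(x)(\omega)}\right)=0.$$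
   Context: $\mu$ is a probability measure on the measurable space $(\Omega,\mathcal F)$, and $T:\Omega\to\Omega$ is invertible, bi-measurable, preserves $\mu$, and is ergodic (every invariant measurable set has measure $0$ or $1$). For $\omega\in\Omega$ (the environment) and $x\in\mathbb Z$, the conductance of the edge $\{x,x+1\}$ is $c(x,x+1)(\omega)=c(x+1,x)(\omega):=c(T^x\omega)$. Put $\overline c(x)(\omega):=c(x-1,x)(\omega)+c(x,x+1)(\omega)$. As a function on $\Omega$, $\overline c$ denotes $\omega\mapsto\overline c(0)(\omega)=c(T^{-1}\omega)+c(\omega)$. For fixed $\omega$ and $x_0\in\mathbb Z$, under $\mathbb P^\omega_{x_0}$, $(S_n)_{n\ge0}$ is the Markov chain on $\mathbb Z$ with $S_0=x_0$ and transition probabilities $\mathbb P^\omega_{x_0}[S_{n+1}=x\pm1\mid S_n=x]=c(x,x\pm1)(\omega)/\overline c(x)(\omega)$. For $r>0$, $B(0,r)$ is the set of integers $z\in\mathbb Z$ with $|z|<r$. *)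

theory Defs
  imports "HOL-Probability.Probability"
begin

locale ergodic_invertible_system = prob_space M for M :: "'a measure" +
  fixes T :: "'a \<Rightarrow> 'a"
  assumes bij_T: "bij_betw T (space M) (space M)"
    and measurable_T: "T \<in> measurable M M"
    and measurable_T_inv: "inv_into (space M) T \<in> measurable M M"
    and preserving: "distr M M T = M"
    and ergodic: "\<And>A. A \<in> sets M \<Longrightarrow> T -` A \<inter> space M = A \<Longrightarrow> prob A = 0 \<or> prob A = 1"

definition int_iterate :: "'a measure \<Rightarrow> ('a \<Rightarrow> 'a) \<Rightarrow> int \<Rightarrow> 'a \<Rightarrow> 'a" where
  "int_iterate M T x \<omega> =
     (if 0 \<le> x then (T ^^ nat x) \<omega> else (inv_into (space M) T ^^ nat (- x)) \<omega>)"

text \<open>Pairs of integers that are not nearest neighbours carry conductance zero.\<close>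

definition conductance ::
  "'a measure \<Rightarrow> ('a \<Rightarrow> 'a) \<Rightarrow> ('a \<Rightarrow> real) \<Rightarrow> 'a \<Rightarrow> int \<Rightarrow> int \<Rightarrow> real" where
  "conductance M T c \<omega> x y =
     (if y = x + 1 then c (int_iterate M T x \<omega>)
      else if y = x - 1 then c (int_iterate M T y \<omega>)
      else 0)"

definition total_conductance ::
  "'a measure \<Rightarrow> ('a \<Rightarrow> 'a) \<Rightarrow> ('a \<Rightarrow> real) \<Rightarrow> 'a \<Rightarrow> int \<Rightarrow> real" where
  "total_conductance M T c \<omega> x =
     conductance M T c \<omega> (x - 1) x + conductance M T c \<omega> x (x + 1)"

definition transition_prob ::
  "'a measure \<Rightarrow> ('a \<Rightarrow> 'a) \<Rightarrow> ('a \<Rightarrow> real) \<Rightarrow> 'a \<Rightarrow> int \<Rightarrow> int \<Rightarrow> real" where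
  "transition_prob M T c \<omega> x y = conductance M T c \<omega> x y / total_conductance M T c \<omega> x"

text \<open>Under \<open>P\<close>, the process \<open>S\<close> is a Markov chain on the integers started at \<open>x\<^sub>0\<close> with
  one-step transition probabilities \<open>p\<close>. Conditioning is only constrained on histories of
  positive probability.\<close>

definition markov_chain ::
  "'b measure \<Rightarrow> (nat \<Rightarrow> 'b \<Rightarrow> int) \<Rightarrow> int \<Rightarrow> (int \<Rightarrow> int \<Rightarrow> real) \<Rightarrow> bool" where
  "markov_chain P S x\<^sub>0 p \<longleftrightarrow>
     prob_space P \<and>
     (\<forall>n. S n \<in> measurable P (count_space UNIV)) \<and>
     (AE w in P. S 0 w = x\<^sub>0) \<and>
     (\<forall>n (h :: nat \<Rightarrow> int) y.
        \<P>(w in P. \<forall>i\<le>n. S i w = h i) > 0 \<longrightarrow>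
        \<P>(w in P. S (Suc n) w = y \<bar> \<forall>i\<le>n. S i w = h i) = p (h n) y)"

end

theory Submission
  imports Defs "HOL-Real_Asymp.Real_Asymp"
begin

text \<open>
  Fix an environment and write \<open>h\<^sub>n\<close> for the density of the law of \<open>S\<^sub>n\<close> with respect to the reversible
  measure. On a line the resistance between two points is the sum of \<open>1 / c\<close> over the edges between
  them, and a function varies by at most the square root of its Dirichlet energy times that
  resistance. Since \<open>h\<^sub>n + h\<^sub>n\<^sub>+\<^sub>1\<close> has total mass \<open>2\<close>, its smallest value on an interval is at most \<open>2\<close>
  divided by the conductance of the interval. Together these bound the value \<open>\<phi>\<^sub>n\<close> at the origin of
  \<open>h\<^sub>2\<^sub>n + h\<^sub>2\<^sub>n\<^sub>+\<^sub>1\<close> once the energy is known (\<open>diag_le\<close>).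

  The energy of \<open>h\<^sub>n + h\<^sub>n\<^sub>+\<^sub>1\<close> is exactly \<open>\<phi>\<^sub>n - \<phi>\<^sub>n\<^sub>+\<^sub>1\<close>, and \<open>\<phi>\<close> is convex because the transition operator is a
  self-adjoint contraction; hence the energy at time \<open>2n\<close> is at most \<open>\<phi>\<^sub>n / n\<close> (\<open>energy_pair_le\<close>).
  The result is \<open>\<phi>\<^sub>n \<le> 4 / V(R) + W(R) / n\<close>, where \<open>V(R)\<close> and \<open>W(R)\<close> are the conductance and the
  resistance of \<open>[0, R]\<close> and \<open>R\<close> is free. The same comparison carries the bound to all points at
  distance of order \<open>sqrt n\<close> (\<open>scaled_dens_le\<close>).

  If \<open>W(R) \<le> C R\<close> then also \<open>V(R) \<ge> R / C\<close>, and \<open>R\<close> of order \<open>sqrt n\<close> gives \<open>\<phi>\<^sub>n = O(1 / sqrt n)\<close>. If moreover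
  \<open>V(R) / R\<close> tends to infinity, then \<open>R\<close> of order \<open>\<epsilon> sqrt n\<close> gives \<open>limsup sqrt n \<phi>\<^sub>n = O(\<epsilon>)\<close>.

  For almost every environment the first hypothesis follows from integrability of \<open>1 / c\<close>, applied to
  \<open>T\<close> and its inverse, and the second from the infinite mean of \<open>c\<close>. Neither needs the convergence of
  Birkhoff averages: both reduce to the fact that the Birkhoff sums of a function with negative mean
  are almost surely bounded above (\<open>birkhoff_sums_bounded_above\<close>).
\<close>

section \<open>Energy estimates for a walk on a line of conductances\<close>

locale line_conductances =
  fixes \<kappa> :: "int \<Rightarrow> real"
  assumes \<kappa>_pos: "0 < \<kappa> x"
begin

text \<open>The reversible measure of the walk.\<close>

definition wt :: "int \<Rightarrow> real" where
  "wt x = \<kappa> (x - 1) + \<kappa> x"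

definition step :: "(int \<Rightarrow> real) \<Rightarrow> int \<Rightarrow> real" where
  "step f x = (\<kappa> (x - 1) * f (x - 1) + \<kappa> x * f (x + 1)) / wt x"

text \<open>The density with respect to \<open>wt\<close> of the law at time \<open>n\<close> of the walk started at \<open>0\<close>. By
  reversibility it evolves under \<open>step\<close>, which is also the transition operator acting on functions.\<close>

fun dens :: "nat \<Rightarrow> int \<Rightarrow> real" where
  "dens 0 = (\<lambda>x. if x = 0 then 1 / wt 0 else 0)"
| "dens (Suc n) = step (dens n)"

text \<open>The density at time \<open>n\<close> vanishes on one of the two parity classes, so its Dirichlet energy stays
  large however flat it is on the other class. Adding two consecutive times fills both classes and
  leaves the values at the right parity unchanged.\<close>

definition pair :: "nat \<Rightarrow> int \<Rightarrow> real" where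
  "pair n x = dens n x + dens (Suc n) x"

definition diag :: "nat \<Rightarrow> real" where
  "diag n = pair (2 * n) 0"

text \<open>The inner product of \<open>L\<^sup>2(wt)\<close>, truncated to a box. All functions used below vanish near the
  boundary of a large enough box, so that no boundary terms occur.\<close>

definition form :: "nat \<Rightarrow> (int \<Rightarrow> real) \<Rightarrow> (int \<Rightarrow> real) \<Rightarrow> real" where
  "form N f g = (\<Sum>x = - int N..int N. wt x * f x * g x)"

definition energy :: "nat \<Rightarrow> (int \<Rightarrow> real) \<Rightarrow> real" where
  "energy N f = (\<Sum>x = - int N..int N. \<kappa> x * (f (x + 1) - f x)\<^sup>2)"

lemma wt_pos: "0 < wt x"
  using \<kappa>_pos[of x] \<kappa>_pos[of "x - 1"] by (simp add: wt_def)

lemma wt_step: "wt x * step f x = \<kappa> (x - 1) * f (x - 1) + \<kappa> x * f (x + 1)"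
  using wt_pos[of x] by (simp add: step_def)

lemma dens_nonneg: "0 \<le> dens n x"
proof (induction n arbitrary: x)
  case 0
  show ?case using wt_pos[of 0] by simp
next
  case (Suc n)
  show ?case
    using Suc wt_pos[of x] \<kappa>_pos[of x] \<kappa>_pos[of "x - 1"]
    by (auto simp: step_def intro!: divide_nonneg_pos add_nonneg_nonneg mult_nonneg_nonneg)
qed

lemma dens_outside: "int n < \<bar>x\<bar> \<Longrightarrow> dens n x = 0"
  by (induction n arbitrary: x) (auto simp: step_def)

lemma pair_outside: "int n + 1 < \<bar>x\<bar> \<Longrightarrow> pair n x = 0"
  using dens_outside[of n x] dens_outside[of "Suc n" x] by (simp add: pair_def del: dens.simps)

lemma pair_nonneg: "0 \<le> pair n x"
  by (simp add: pair_def dens_nonneg del: dens.simps)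

lemma step_pair: "step (pair n) = pair (Suc n)"
proof (rule ext)
  fix x
  have "wt x * step (pair n) x = wt x * pair (Suc n) x"
    by (simp only: pair_def distrib_left wt_step dens.simps)
  then show "step (pair n) x = pair (Suc n) x"
    using wt_pos[of x] by simp
qed

lemma shift_sum:
  fixes u :: "int \<Rightarrow> real"
  assumes "u (- int N) = 0" "u (int N + 1) = 0"
  shows "(\<Sum>x = - int N..int N. u x) = (\<Sum>x = - int N..int N. u (x + 1))"
proof -
  have "(\<Sum>x = - int N..int N. u (x + 1)) = (\<Sum>x = - int N + 1..int N + 1. u x)"
    by (rule sum.reindex_bij_witness[of _ "\<lambda>x. x - 1" "\<lambda>x. x + 1"]) auto
  also have "\<dots> = (\<Sum>x = - int N..int N + 1. u x)"
  proof (rule sum.mono_neutral_left)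
    have "{- int N..int N + 1} - {- int N + 1..int N + 1} = {- int N}"
      by auto
    then show "\<forall>x \<in> {- int N..int N + 1} - {- int N + 1..int N + 1}. u x = 0"
      using assms(1) by simp
  qed auto
  also have "\<dots> = (\<Sum>x = - int N..int N. u x)"
  proof (rule sum.mono_neutral_right)
    have "{- int N..int N + 1} - {- int N..int N} = {int N + 1}"
      by auto
    then show "\<forall>x \<in> {- int N..int N + 1} - {- int N..int N}. u x = 0"
      using assms(2) by simp
  qed auto
  finally show ?thesis by simp
qed

text \<open>Every edge contributes once to each of its endpoints; the shift of the summation index moves both
  contributions to the left endpoint, and makes the symmetry in \<open>f\<close> and \<open>g\<close> visible.\<close>

lemma form_step:
  assumes "g (- int N) = 0" "g (int N + 1) = 0"
  shows "form N (step f) g = (\<Sum>x = - int N..int N. \<kappa> x * (f x * g (x + 1) + f (x + 1) * g x))"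
proof -
  have "form N (step f) g
      = (\<Sum>x = - int N..int N. \<kappa> (x - 1) * f (x - 1) * g x) + (\<Sum>x = - int N..int N. \<kappa> x * f (x + 1) * g x)"
    unfolding form_def by (simp add: wt_step distrib_right sum.distrib)
  also have "(\<Sum>x = - int N..int N. \<kappa> (x - 1) * f (x - 1) * g x)
      = (\<Sum>x = - int N..int N. \<kappa> x * f x * g (x + 1))"
    by (subst shift_sum) (use assms in auto)
  finally show ?thesis by (simp add: algebra_simps sum.distrib)
qed

lemma form_step_sym:
  assumes "f (- int N) = 0" "f (int N + 1) = 0" "g (- int N) = 0" "g (int N + 1) = 0"
  shows "form N (step f) g = form N f (step g)"
proof -
  have "form N f (step g) = form N (step g) f"
    by (simp add: form_def mult_ac)
  then show ?thesis using assms by (simp add: form_step algebra_simps)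
qed

lemma form_self:
  assumes "f (- int N) = 0" "f (int N + 1) = 0"
  shows "form N f f = (\<Sum>x = - int N..int N. \<kappa> x * ((f x)\<^sup>2 + (f (x + 1))\<^sup>2))"
proof -
  have "form N f f = (\<Sum>x = - int N..int N. \<kappa> (x - 1) * (f x)\<^sup>2) + (\<Sum>x = - int N..int N. \<kappa> x * (f x)\<^sup>2)"
    by (simp add: form_def wt_def algebra_simps sum.distrib power2_eq_square)
  also have "(\<Sum>x = - int N..int N. \<kappa> (x - 1) * (f x)\<^sup>2) = (\<Sum>x = - int N..int N. \<kappa> x * (f (x + 1))\<^sup>2)"
    by (subst shift_sum) (use assms in auto)
  finally show ?thesis by (simp add: algebra_simps sum.distrib)
qed

lemma energy_eq_form:
  assumes "f (- int N) = 0" "f (int N + 1) = 0"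
  shows "energy N f = form N f f - form N (step f) f"
  unfolding form_self[OF assms] form_step[OF assms] energy_def sum_subtractf[symmetric]
  by (rule sum.cong) (auto simp: power2_eq_square algebra_simps)

text \<open>The walk has period two, so the spectrum of \<open>step\<close> may reach \<open>-1\<close>; this says that it goes no
  further. It is what makes the return densities convex.\<close>

lemma form_plus_step_nonneg:
  assumes "f (- int N) = 0" "f (int N + 1) = 0"
  shows "0 \<le> form N f f + form N (step f) f"
proof -
  have "form N f f + form N (step f) f = (\<Sum>x = - int N..int N. \<kappa> x * (f (x + 1) + f x)\<^sup>2)"
    unfolding form_self[OF assms] form_step[OF assms] sum.distrib[symmetric]
    by (rule sum.cong) (auto simp: power2_eq_square algebra_simps)
  then show ?thesis
    by (simp add: sum_nonneg less_imp_le[OF \<kappa>_pos])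
qed

text \<open>Self-adjointness moves all steps to one side, where the other factor is the unit mass at the
  origin.\<close>

lemma form_dens: "i + j \<le> N \<Longrightarrow> form N (dens i) (dens j) = dens (i + j) 0"
proof (induction i arbitrary: j)
  case 0
  have "form N (dens 0) (dens j) = (\<Sum>x = - int N..int N. if x = 0 then dens j 0 else 0)"
    unfolding form_def by (rule sum.cong) (use wt_pos[of 0] in auto)
  then show ?case by simp
next
  case (Suc i)
  have "form N (dens (Suc i)) (dens j) = form N (step (dens i)) (dens j)"
    by simp
  also have "\<dots> = form N (dens i) (step (dens j))"
    by (rule form_step_sym) (use Suc.prems in \<open>auto intro!: dens_outside\<close>)
  also have "\<dots> = dens (i + Suc j) 0"
    using Suc.IH[of "Suc j"] Suc.prems by simp
  finally show ?case by simp
qed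

lemma form_add_left: "form N (\<lambda>x. f x + g x) h = form N f h + form N g h"
  by (simp add: form_def algebra_simps sum.distrib)

lemma form_add_right: "form N h (\<lambda>x. f x + g x) = form N h f + form N h g"
  by (simp add: form_def algebra_simps sum.distrib)

lemma form_diff_left: "form N (\<lambda>x. f x - g x) h = form N f h - form N g h"
  by (simp add: form_def algebra_simps sum_subtractf)

lemma form_diff_right: "form N h (\<lambda>x. f x - g x) = form N h f - form N h g"
  by (simp add: form_def algebra_simps sum_subtractf)

lemma form_pair:
  assumes "i + j + 2 \<le> N"
  shows "form N (pair i) (pair j) = pair (i + j) 0 + pair (i + j + 1) 0"
proof -
  have "pair k = (\<lambda>x. dens k x + dens (Suc k) x)" for k
    by (rule ext) (simp add: pair_def)
  then show ?thesis
    using assms by (simp add: form_add_left form_add_right form_dens del: dens.simps)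
qed

lemma energy_pair:
  assumes "2 * n + 3 \<le> N"
  shows "energy N (pair n) = diag n - diag (Suc n)"
proof -
  have "energy N (pair n) = form N (pair n) (pair n) - form N (pair (Suc n)) (pair n)"
    by (subst energy_eq_form) (use assms in \<open>auto intro!: pair_outside simp: step_pair\<close>)
  moreover have "diag n = pair (n + n) 0" "diag (Suc n) = pair (Suc n + n + 1) 0"
    by (simp_all add: diag_def flip: mult_2)
  ultimately show ?thesis
    using form_pair[of n n N] form_pair[of "Suc n" n N] assms by simp
qed

text \<open>For \<open>u = pair n - pair (n + 1)\<close>, which is \<open>(1 - step)\<close> applied to \<open>pair n\<close>, the second
  difference of \<open>diag\<close> is the inner product of \<open>u\<close> with \<open>(1 + step) u\<close>.\<close>

lemma diag_convex: "diag (Suc n) - diag (Suc (Suc n)) \<le> diag n - diag (Suc n)"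
proof -
  define N where "N = 2 * n + 5"
  define u where "u = (\<lambda>x. pair n x - pair (Suc n) x)"
  have su: "step u = (\<lambda>x. pair (Suc n) x - pair (Suc (Suc n)) x)"
  proof (rule ext)
    fix x
    have "wt x * step u x = wt x * (pair (Suc n) x - pair (Suc (Suc n)) x)"
      by (simp only: step_pair[symmetric] right_diff_distrib wt_step u_def)
    then show "step u x = pair (Suc n) x - pair (Suc (Suc n)) x"
      using wt_pos[of x] by simp
  qed
  have "0 \<le> form N u u + form N (step u) u"
    by (rule form_plus_step_nonneg) (auto simp: u_def N_def pair_outside)
  also have "\<dots> = diag n - 2 * diag (Suc n) + diag (Suc (Suc n))"
  proof -
    have form_shift: "form N (pair (n + i)) (pair (n + j))
        = pair (2 * n + (i + j)) 0 + pair (2 * n + (i + j + 1)) 0" if "i + j \<le> 3" for i j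
    proof -
      have "n + i + (n + j) = 2 * n + (i + j)" "n + i + (n + j) + 2 \<le> N"
        using that by (simp_all add: N_def)
      then show ?thesis
        using form_pair[of "n + i" "n + j" N] by (simp only: add.assoc)
    qed
    have diag_shift: "diag (n + i) = pair (2 * n + 2 * i) 0" for i
      by (simp only: diag_def add_mult_distrib2)
    show ?thesis
      using form_shift[of 0 0] form_shift[of 0 1] form_shift[of 1 0] form_shift[of 1 1]
        form_shift[of 2 0] form_shift[of 2 1] diag_shift[of 0] diag_shift[of 1] diag_shift[of 2]
      unfolding su unfolding u_def form_diff_left form_diff_right
      by (simp add: numeral_2_eq_2 numeral_3_eq_3 eval_nat_numeral)
  qed
  finally show ?thesis by simp
qed

lemma diag_nonneg: "0 \<le> diag n"
  by (simp add: diag_def pair_nonneg)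

text \<open>The energy of \<open>pair (2 * n)\<close> is a decrement of \<open>diag\<close> at time \<open>2 * n\<close>. By convexity it is at
  most the average of the \<open>n\<close> decrements between \<open>n\<close> and \<open>2 * n\<close>, whose sum telescopes.\<close>

lemma energy_pair_le:
  assumes "1 \<le> n" "4 * n + 3 \<le> N"
  shows "energy N (pair (2 * n)) \<le> diag n / n"
proof -
  define d where "d k = diag k - diag (Suc k)" for k
  have "decseq d"
    unfolding decseq_Suc_iff d_def using diag_convex by simp
  then have "d (2 * n) \<le> d k" if "k \<in> {n..<2 * n}" for k
    using that by (auto simp: decseq_def)
  then have "(\<Sum>k = n..<2 * n. d (2 * n)) \<le> (\<Sum>k = n..<2 * n. d k)"
    by (rule sum_mono)
  also have "\<dots> = diag n - diag (2 * n)"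
    using sum_Suc_diff'[of n "2 * n" "\<lambda>k. - diag k"] by (simp add: d_def)
  finally have "n * d (2 * n) \<le> diag n"
    using diag_nonneg[of "2 * n"] by simp
  then have "d (2 * n) \<le> diag n / n"
    using assms(1) by (simp add: pos_le_divide_eq mult.commute)
  moreover have "energy N (pair (2 * n)) = d (2 * n)"
    unfolding d_def by (rule energy_pair) (use assms(2) in simp)
  ultimately show ?thesis by simp
qed

lemma mass_dens: "n \<le> N \<Longrightarrow> (\<Sum>x = - int N..int N. wt x * dens n x) = 1"
proof (induction n)
  case 0
  have "wt x * dens 0 x = (if x = 0 then 1 else 0)" for x
    using wt_pos[of 0] by simp
  then show ?case by simp
next
  case (Suc n)
  let ?D = "{- int N..int N}"
  have "(\<Sum>x\<in>?D. wt x * dens (Suc n) x)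
      = (\<Sum>x\<in>?D. \<kappa> (x - 1) * dens n (x - 1)) + (\<Sum>x\<in>?D. \<kappa> x * dens n (x + 1))"
    by (simp add: wt_step sum.distrib)
  also have "(\<Sum>x\<in>?D. \<kappa> (x - 1) * dens n (x - 1)) = (\<Sum>x\<in>?D. \<kappa> x * dens n x)"
    by (subst shift_sum) (use Suc.prems in \<open>auto simp: dens_outside\<close>)
  also have "(\<Sum>x\<in>?D. \<kappa> x * dens n (x + 1)) = (\<Sum>x\<in>?D. \<kappa> (x - 1) * dens n x)"
    by (subst (2) shift_sum) (use Suc.prems in \<open>auto simp: dens_outside\<close>)
  also have "(\<Sum>x\<in>?D. \<kappa> x * dens n x) + \<dots> = (\<Sum>x\<in>?D. wt x * dens n x)"
    by (simp add: wt_def algebra_simps sum.distrib)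
  finally show ?case using Suc by simp
qed

text \<open>The increments of \<open>f\<close> are controlled edge by edge by \<open>2 d \<le> t \<kappa> d\<^sup>2 + 1 / (t \<kappa>)\<close>. Keeping \<open>t\<close> free
  replaces the square root of energy times resistance by a linear bound.\<close>

lemma oscillation:
  fixes a b :: int
  assumes "a \<le> b" "0 < t"
  shows "\<bar>f b - f a\<bar> \<le> (t * (\<Sum>x = a..<b. \<kappa> x * (f (x + 1) - f x)\<^sup>2) + (\<Sum>x = a..<b. 1 / \<kappa> x) / t) / 2"
  using assms(1)
proof (induction b rule: int_ge_induct)
  case base
  show ?case by simp
next
  case (step b)
  let ?d = "\<bar>f (b + 1) - f b\<bar>"
  have "0 \<le> (t * \<kappa> b * ?d - 1)\<^sup>2 / (t * \<kappa> b)"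
    using \<kappa>_pos[of b] assms(2) by simp
  also have "\<dots> = t * (\<kappa> b * ?d\<^sup>2) + (1 / \<kappa> b) / t - 2 * ?d"
    using \<kappa>_pos[of b] assms(2) by (simp add: power2_eq_square field_simps)
  finally have "?d \<le> (t * (\<kappa> b * (f (b + 1) - f b)\<^sup>2) + (1 / \<kappa> b) / t) / 2"
    by simp
  moreover have "{a..<b + 1} = insert b {a..<b}"
    using step.hyps by auto
  moreover have "\<bar>f (b + 1) - f a\<bar> \<le> ?d + \<bar>f b - f a\<bar>"
    by linarith
  ultimately show ?case
    using step.IH by (simp add: algebra_simps add_divide_distrib)
qed

lemma pair_oscillation:
  assumes "a \<le> b" "1 \<le> n" "0 < s"
  shows "\<bar>pair (2 * n) b - pair (2 * n) a\<bar> \<le> (s * diag n + (\<Sum>x = a..<b. 1 / \<kappa> x) / (s * n)) / 2"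
proof -
  define N where "N = 4 * n + 3 + nat \<bar>a\<bar> + nat \<bar>b\<bar>"
  let ?f = "pair (2 * n)"
  have "(\<Sum>x = a..<b. \<kappa> x * (?f (x + 1) - ?f x)\<^sup>2) \<le> energy N ?f"
    unfolding energy_def
    by (rule sum_mono2) (auto simp: N_def less_imp_le[OF \<kappa>_pos])
  also have "\<dots> \<le> diag n / n"
    using assms by (intro energy_pair_le) (auto simp: N_def)
  finally have "s * n * (\<Sum>x = a..<b. \<kappa> x * (?f (x + 1) - ?f x)\<^sup>2) \<le> s * n * (diag n / n)"
    by (rule mult_left_mono) (use assms in auto)
  also have "\<dots> = s * diag n"
    using assms by simp
  finally have "(s * n * (\<Sum>x = a..<b. \<kappa> x * (?f (x + 1) - ?f x)\<^sup>2) + (\<Sum>x = a..<b. 1 / \<kappa> x) / (s * n)) / 2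
      \<le> (s * diag n + (\<Sum>x = a..<b. 1 / \<kappa> x) / (s * n)) / 2"
    by (intro divide_right_mono add_right_mono) auto
  moreover have "0 < s * n"
    using assms by simp
  ultimately show ?thesis
    using oscillation[OF assms(1), of "s * n" ?f] by (blast intro: order_trans)
qed

text \<open>The total mass of \<open>pair (2 * n)\<close> is \<open>2\<close>, so its average over the edges of \<open>{0..R}\<close>, weighted
  by \<open>\<kappa>\<close>, is at most \<open>2\<close> divided by their total conductance. The oscillation bound compares this
  average with the value \<open>diag n\<close> at the origin; half of \<open>diag n\<close> is absorbed on the left.\<close>

lemma diag_le:
  assumes "1 \<le> n" "1 \<le> R"
  shows "diag n \<le> 4 / (\<Sum>x = 0..<int R. \<kappa> x) + (\<Sum>x = 0..<int R. 1 / \<kappa> x) / n"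
proof -
  let ?f = "pair (2 * n)" and ?V = "\<Sum>x = 0..<int R. \<kappa> x" and ?W = "\<Sum>x = 0..<int R. 1 / \<kappa> x"
  define N where "N = 2 * n + 1 + R"
  have V: "0 < ?V"
    by (rule sum_pos) (use assms \<kappa>_pos in auto)
  have "\<kappa> y * (diag n - ?W / n) \<le> 2 * (\<kappa> y * ?f y)" if "y \<in> {0..<int R}" for y
  proof -
    have "(\<Sum>x = 0..<y. 1 / \<kappa> x) \<le> ?W"
      by (rule sum_mono2) (use that in \<open>auto simp: less_imp_le[OF \<kappa>_pos]\<close>)
    then have "(\<Sum>x = 0..<y. 1 / \<kappa> x) / n \<le> ?W / n"
      by (rule divide_right_mono) simp
    moreover have "\<bar>?f y - diag n\<bar> \<le> (diag n + (\<Sum>x = 0..<y. 1 / \<kappa> x) / n) / 2"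
      using pair_oscillation[of 0 y n 1] that assms(1) by (simp add: diag_def)
    moreover have "d - v \<le> 2 * p" if "u \<le> v" "\<bar>p - d\<bar> \<le> (d + u) / 2" for d p u v :: real
      using that unfolding abs_le_iff by (simp add: field_simps)
    ultimately have "diag n - ?W / n \<le> 2 * ?f y"
      by blast
    then show ?thesis
      using mult_left_mono[of "diag n - ?W / n" "2 * ?f y" "\<kappa> y"] \<kappa>_pos[of y] by simp
  qed
  then have "(\<Sum>y = 0..<int R. \<kappa> y * (diag n - ?W / n)) \<le> (\<Sum>y = 0..<int R. 2 * (\<kappa> y * ?f y))"
    by (rule sum_mono)
  then have "?V * (diag n - ?W / n) \<le> 2 * (\<Sum>y = 0..<int R. \<kappa> y * ?f y)"
    by (simp only: sum_distrib_left[symmetric] sum_distrib_right[symmetric])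
  also have "(\<Sum>y = 0..<int R. \<kappa> y * ?f y) \<le> (\<Sum>y = 0..<int R. wt y * ?f y)"
    by (intro sum_mono mult_right_mono pair_nonneg) (simp add: wt_def less_imp_le[OF \<kappa>_pos])
  also have "\<dots> \<le> (\<Sum>y = - int N..int N. wt y * ?f y)"
    by (rule sum_mono2) (auto simp: N_def pair_nonneg less_imp_le[OF wt_pos])
  also have "\<dots> = 1 + 1"
    unfolding pair_def distrib_left sum.distrib
    by (intro arg_cong2[of _ _ _ _ "(+)"] mass_dens) (simp_all add: N_def)
  finally have "diag n - ?W / n \<le> 4 / ?V"
    using V by (simp add: pos_le_divide_eq mult.commute)
  then show ?thesis by simp
qed

section \<open>Diffusive scaling\<close>

text \<open>A bound on the resistance of an interval bounds its conductance from below, by the Cauchy--Schwarz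
  inequality for \<open>1 = sqrt (\<kappa> y) * sqrt (1 / \<kappa> y)\<close>.\<close>

lemma conductance_sum_ge:
  assumes C: "(\<Sum>y = 0..<int R. 1 / \<kappa> y) \<le> C * real R" and "1 \<le> R"
  shows "0 < C" "real R / C \<le> (\<Sum>y = 0..<int R. \<kappa> y)"
proof -
  let ?V = "\<Sum>y = 0..<int R. \<kappa> y" and ?W = "\<Sum>y = 0..<int R. 1 / \<kappa> y"
  have "0 < ?W"
    by (rule sum_pos) (use \<kappa>_pos \<open>1 \<le> R\<close> in auto)
  with C have "0 < C * real R"
    by linarith
  then show "0 < C"
    by (simp add: zero_less_mult_iff)
  have "(\<Sum>y = 0..<int R. sqrt (\<kappa> y) * sqrt (1 / \<kappa> y))\<^sup>2
      \<le> (\<Sum>y = 0..<int R. (sqrt (\<kappa> y))\<^sup>2) * (\<Sum>y = 0..<int R. (sqrt (1 / \<kappa> y))\<^sup>2)"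
    by (rule Cauchy_Schwarz_ineq_sum)
  moreover have "sqrt (\<kappa> y) * sqrt (1 / \<kappa> y) = 1" for y
    using \<kappa>_pos[of y] by (simp add: real_sqrt_divide)
  ultimately have "(real R)\<^sup>2 \<le> ?V * ?W"
    by (simp add: less_imp_le[OF \<kappa>_pos])
  also have "\<dots> \<le> ?V * (C * real R)"
    by (rule mult_left_mono[OF C]) (simp add: sum_nonneg less_imp_le[OF \<kappa>_pos])
  finally have "real R * real R \<le> (?V * C) * real R"
    by (simp add: power2_eq_square mult_ac)
  then have "real R \<le> ?V * C"
    using \<open>1 \<le> R\<close> by (simp add: mult_le_cancel_right)
  then show "real R / C \<le> ?V"
    using \<open>0 < C\<close> by (simp add: pos_divide_le_eq)
qed

lemma scaled_diag_le:
  assumes C: "(\<Sum>y = 0..<int R. 1 / \<kappa> y) \<le> C * real R" and "1 \<le> R" "1 \<le> n"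
  shows "sqrt (2 * real n) * diag n
       \<le> 4 * sqrt (2 * real n) / (\<Sum>y = 0..<int R. \<kappa> y) + 2 * C * real R / sqrt (2 * real n)"
proof -
  let ?V = "\<Sum>y = 0..<int R. \<kappa> y"
  define r where "r = sqrt (2 * real n)"
  have r: "0 < r" "real n = r * r / 2"
    using \<open>1 \<le> n\<close> by (auto simp: r_def)
  have "diag n \<le> 4 / ?V + (\<Sum>y = 0..<int R. 1 / \<kappa> y) / n"
    by (rule diag_le) fact+
  also have "\<dots> \<le> 4 / ?V + C * real R / n"
    by (intro add_left_mono divide_right_mono C) simp
  finally have "r * diag n \<le> r * (4 / ?V + C * real R / n)"
    using r(1) by (intro mult_left_mono) auto
  also have "\<dots> = 4 * r / ?V + 2 * C * real R / r"
    using r(1) unfolding r(2) by (simp add: distrib_left mult.commute)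
  finally show ?thesis
    by (simp only: r_def)
qed

text \<open>The diffusive choice \<open>R \<approx> sqrt (2 * n)\<close> balances the two terms of the preceding bound.\<close>

lemma scaled_diag_bounded:
  assumes C: "\<And>R. (\<Sum>y = 0..<int R. 1 / \<kappa> y) \<le> C * real R" and "1 \<le> n"
  shows "sqrt (2 * real n) * diag n \<le> 8 * C"
proof -
  define r where "r = sqrt (2 * real n)"
  define R where "R = nat \<lceil>r\<rceil>"
  have r: "1 \<le> r"
    using \<open>1 \<le> n\<close> by (simp add: r_def)
  then have R: "r \<le> R" "R \<le> 2 * r" "1 \<le> R"
    unfolding R_def by linarith+
  have "0 < C"
    by (rule conductance_sum_ge(1)[OF C R(3)])
  have "r * diag n \<le> 4 * r / (\<Sum>y = 0..<int R. \<kappa> y) + 2 * C * R / r"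
    using scaled_diag_le[OF C R(3) \<open>1 \<le> n\<close>] by (simp only: r_def)
  also have "4 * r / (\<Sum>y = 0..<int R. \<kappa> y) \<le> 4 * r / (R / C)"
    using conductance_sum_ge(2)[OF C R(3)] r R \<open>0 < C\<close> by (intro divide_left_mono mult_pos_pos) (auto intro: less_le_trans[rotated])
  also have "\<dots> \<le> 4 * C"
    using R r \<open>0 < C\<close> by (simp add: pos_divide_le_eq)
  also have "2 * C * R / r \<le> 4 * C"
    using R r \<open>0 < C\<close> by (simp add: pos_divide_le_eq)
  finally show ?thesis
    by (simp add: r_def)
qed

text \<open>With \<open>R \<approx> e * sqrt (2 * n)\<close> the resistance term is of order \<open>C * e\<close>. The volume term is of order
  \<open>1 / (K * e)\<close> as soon as the conductance of \<open>{0..R}\<close> exceeds \<open>K * R\<close>, and \<open>K\<close> may depend on \<open>e\<close>.\<close>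

lemma scaled_diag_tendsto_0:
  assumes C: "\<And>R. (\<Sum>y = 0..<int R. 1 / \<kappa> y) \<le> C * real R"
    and V: "\<And>K. \<exists>B. \<forall>R. K * real R - B \<le> (\<Sum>y = 0..<int R. \<kappa> y)"
  shows "(\<lambda>n. sqrt (2 * real n) * diag n) \<longlonglongrightarrow> 0"
proof (rule LIMSEQ_I)
  fix \<eta> :: real assume "0 < \<eta>"
  have "0 < C"
    using conductance_sum_ge(1)[OF C, of 1] by simp
  \<comment> \<open>The volume term will be at most \<open>8 * e\<close> and the resistance term at most \<open>4 * C * e\<close>.\<close>
  define e where "e = \<eta> / (9 + 4 * C)"
  have e: "0 < e" "(8 + 4 * C) * e < \<eta>"
    using \<open>0 < \<eta>\<close> \<open>0 < C\<close> by (auto simp: e_def pos_divide_less_eq intro!: mult_strict_right_mono)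
  define K where "K = 1 / e\<^sup>2"
  obtain B where B: "\<And>R. K * real R - B \<le> (\<Sum>y = 0..<int R. \<kappa> y)"
    using V[of K] by blast
  have "filterlim (\<lambda>n. sqrt (2 * real n)) at_top sequentially"
    by real_asymp
  then have "\<forall>\<^sub>F n in sequentially. max (1 / e) (2 * B * e) \<le> sqrt (2 * real n)"
    by (simp only: filterlim_at_top)
  moreover have "\<forall>\<^sub>F n :: nat in sequentially. 1 \<le> n"
    by (rule eventually_ge_at_top)
  ultimately have "\<forall>\<^sub>F n in sequentially. norm (sqrt (2 * real n) * diag n - 0) < \<eta>"
  proof eventually_elim
    case (elim n)
    define r where "r = sqrt (2 * real n)"
    define R where "R = nat \<lceil>e * r\<rceil>"
    have r: "1 / e \<le> r" "2 * B * e \<le> r" "0 < r"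
      using elim by (auto simp: r_def)
    have er: "1 \<le> e * r"
      using r(1) e(1) by (simp add: pos_divide_le_eq mult.commute)
    then have R: "e * r \<le> R" "R \<le> 2 * (e * r)" "1 \<le> R"
      unfolding R_def by linarith+
    have Ke: "K * (e * r) = r / e"
      using e(1) by (simp add: K_def power2_eq_square)
    have "B \<le> r / (2 * e)"
      using r(2) e(1) by (simp add: pos_le_divide_eq mult_ac)
    moreover have "K * (e * r) \<le> K * R"
      by (intro mult_left_mono R) (simp add: K_def)
    ultimately have Vge: "r / (2 * e) \<le> (\<Sum>y = 0..<int R. \<kappa> y)"
      using B[of R] Ke by (simp add: field_simps)
    have "r * diag n \<le> 4 * r / (\<Sum>y = 0..<int R. \<kappa> y) + 2 * C * R / r"
      using scaled_diag_le[OF C R(3) elim(2)] by (simp only: r_def)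
    also have "4 * r / (\<Sum>y = 0..<int R. \<kappa> y) \<le> 4 * r / (r / (2 * e))"
    proof (rule divide_left_mono[OF Vge])
      have "0 < r / (2 * e)" using r e by simp
      with Vge show "0 < (\<Sum>y = 0..<int R. \<kappa> y) * (r / (2 * e))"
        by (intro mult_pos_pos) linarith+
    qed (use r in simp)
    also have "\<dots> = 8 * e"
      using r(3) by simp
    also have "2 * C * R / r \<le> 2 * C * (2 * (e * r)) / r"
      using R(2) r(3) \<open>0 < C\<close> by (intro divide_right_mono mult_left_mono) auto
    also have "\<dots> = 4 * C * e"
      using r(3) by simp
    finally have "r * diag n < \<eta>"
      using e(2) by (simp add: algebra_simps)
    moreover have "0 \<le> r * diag n"
      using r diag_nonneg by simp
    ultimately show ?case
      by (simp add: r_def)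
  qed
  then show "\<exists>no. \<forall>n\<ge>no. norm (sqrt (2 * real n) * diag n - 0) < \<eta>"
    by (simp only: eventually_sequentially)
qed

text \<open>The oscillation bound carries the estimate from the origin to the points of the window. The free
  parameter \<open>s\<close> decouples the error \<open>C * a / s\<close> from the factor in front of \<open>diag n\<close>.\<close>

lemma scaled_dens_le:
  assumes Cp: "\<And>R. (\<Sum>y = 0..<int R. 1 / \<kappa> y) \<le> C * real R"
    and Cm: "\<And>R. (\<Sum>y = - int R..<0. 1 / \<kappa> y) \<le> C * real R"
    and "1 \<le> n" "0 < s" "\<bar>real_of_int x\<bar> < a * sqrt (2 * real n)"
  shows "sqrt (2 * real n) * dens (2 * n) x \<le> (1 + s / 2) * (sqrt (2 * real n) * diag n) + C * a / s"
proof -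
  define r where "r = sqrt (2 * real n)"
  have r: "0 < r" "real n = r * r / 2"
    using \<open>1 \<le> n\<close> by (auto simp: r_def)
  have "0 < C"
    using conductance_sum_ge(1)[OF Cp, of 1] by simp
  have "\<exists>W. \<bar>pair (2 * n) x - diag n\<bar> \<le> (s * diag n + W / (s * n)) / 2 \<and> W \<le> C * \<bar>real_of_int x\<bar>"
  proof (cases "0 \<le> x")
    case True
    then show ?thesis
      using pair_oscillation[of 0 x n s] Cp[of "nat x"] assms(3,4) by (auto simp: diag_def)
  next
    case False
    then show ?thesis
      using pair_oscillation[of x 0 n s] Cm[of "nat (- x)"] assms(3,4)
      by (auto simp: diag_def abs_minus_commute)
  qed
  then obtain W where osc: "\<bar>pair (2 * n) x - diag n\<bar> \<le> (s * diag n + W / (s * n)) / 2"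
    and W: "W \<le> C * \<bar>real_of_int x\<bar>"
    by blast
  have "C * \<bar>real_of_int x\<bar> \<le> C * (a * r)"
    using assms(5) \<open>0 < C\<close> by (simp add: r_def)
  with W have "W / (s * n) \<le> C * (a * r) / (s * n)"
    using assms(3,4) by (intro divide_right_mono) auto
  moreover have "p \<le> d + (e + v) / 2" if "u \<le> v" "\<bar>p - d\<bar> \<le> (e + u) / 2" for d e p u v :: real
    using that unfolding abs_le_iff by (simp add: field_simps)
  ultimately have "pair (2 * n) x \<le> diag n + (s * diag n + C * (a * r) / (s * n)) / 2"
    using osc by blast
  moreover have "dens (2 * n) x \<le> pair (2 * n) x"
    using dens_nonneg[of "Suc (2 * n)" x] by (simp only: pair_def)
  ultimately have "r * dens (2 * n) x \<le> r * (diag n + (s * diag n + C * (a * r) / (s * n)) / 2)"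
    using r(1) by (intro mult_left_mono) auto
  also have "\<dots> = (1 + s / 2) * (r * diag n) + C * a / s"
    using r(1) assms(4) unfolding r(2) by (simp add: field_simps)
  finally show ?thesis
    by (simp only: r_def)
qed

lemma finite_window: "finite {x :: int. \<bar>real_of_int x\<bar> < t \<and> even x}"
proof (rule finite_subset)
  show "{x :: int. \<bar>real_of_int x\<bar> < t \<and> even x} \<subseteq> {- \<lceil>t\<rceil>..\<lceil>t\<rceil>}"
    by (auto; linarith)
qed simp

definition scaled_max :: "real \<Rightarrow> nat \<Rightarrow> real" where
  "scaled_max a n = sqrt (2 * real n) *
     (MAX x \<in> {x :: int. \<bar>real_of_int x\<bar> < a * sqrt (2 * real n) \<and> even x}. dens (2 * n) x)"

lemma scaled_max_bounds:
  assumes Cp: "\<And>R. (\<Sum>y = 0..<int R. 1 / \<kappa> y) \<le> C * real R"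
    and Cm: "\<And>R. (\<Sum>y = - int R..<0. 1 / \<kappa> y) \<le> C * real R"
    and "1 \<le> n" "0 < s" "0 < a"
  shows "0 \<le> scaled_max a n"
    and "scaled_max a n \<le> (1 + s / 2) * (sqrt (2 * real n) * diag n) + C * a / s"
proof -
  let ?X = "{x :: int. \<bar>real_of_int x\<bar> < a * sqrt (2 * real n) \<and> even x}"
  have "0 \<in> ?X"
    using assms by simp
  then have "?X \<noteq> {}"
    by blast
  then have "Max (dens (2 * n) ` ?X) \<in> dens (2 * n) ` ?X"
    by (intro Max_in) (simp_all only: finite_imageI finite_window image_is_empty not_False_eq_True)
  then obtain x where x: "x \<in> ?X" "scaled_max a n = sqrt (2 * real n) * dens (2 * n) x"
    unfolding scaled_max_def by auto
  show "0 \<le> scaled_max a n"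
    unfolding x(2) by (simp add: dens_nonneg)
  show "scaled_max a n \<le> (1 + s / 2) * (sqrt (2 * real n) * diag n) + C * a / s"
    unfolding x(2) by (rule scaled_dens_le) (use assms x in auto)
qed

lemma scaled_max_bounded:
  assumes Cp: "\<And>R. (\<Sum>y = 0..<int R. 1 / \<kappa> y) \<le> C * real R"
    and Cm: "\<And>R. (\<Sum>y = - int R..<0. 1 / \<kappa> y) \<le> C * real R"
    and "0 < a"
  shows "bounded (scaled_max a ` {1..})"
proof (rule boundedI)
  fix z assume "z \<in> scaled_max a ` {1..}"
  then obtain n where n: "1 \<le> n" "z = scaled_max a n" by auto
  show "norm z \<le> 12 * C + C * a"
    using scaled_max_bounds[OF Cp Cm n(1) zero_less_one \<open>0 < a\<close>] scaled_diag_bounded[OF Cp n(1)] n(2)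
    by simp
qed

lemma scaled_max_tendsto_0:
  assumes Cp: "\<And>R. (\<Sum>y = 0..<int R. 1 / \<kappa> y) \<le> C * real R"
    and Cm: "\<And>R. (\<Sum>y = - int R..<0. 1 / \<kappa> y) \<le> C * real R"
    and V: "\<And>K. \<exists>B. \<forall>R. K * real R - B \<le> (\<Sum>y = 0..<int R. \<kappa> y)"
    and "0 < a"
  shows "scaled_max a \<longlonglongrightarrow> 0"
proof (rule LIMSEQ_I)
  fix \<eta> :: real assume "0 < \<eta>"
  have "0 < C"
    using conductance_sum_ge(1)[OF Cp, of 1] by simp
  define s where "s = 2 * C * a / \<eta>"
  have s: "0 < s" "C * a / s = \<eta> / 2"
    using \<open>0 < C\<close> \<open>0 < a\<close> \<open>0 < \<eta>\<close> by (auto simp: s_def)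
  have "(\<lambda>n. (1 + s / 2) * (sqrt (2 * real n) * diag n)) \<longlonglongrightarrow> (1 + s / 2) * 0"
    by (rule tendsto_mult_left[OF scaled_diag_tendsto_0[OF Cp V]])
  then have "\<forall>\<^sub>F n in sequentially. (1 + s / 2) * (sqrt (2 * real n) * diag n) < \<eta> / 2"
    by (rule order_tendstoD) (use \<open>0 < \<eta>\<close> in simp)
  moreover have "\<forall>\<^sub>F n :: nat in sequentially. 1 \<le> n"
    by (rule eventually_ge_at_top)
  ultimately have "\<forall>\<^sub>F n in sequentially. norm (scaled_max a n - 0) < \<eta>"
  proof eventually_elim
    case (elim n)
    then show ?case
      using scaled_max_bounds[OF Cp Cm elim(2) s(1) \<open>0 < a\<close>] s(2) by simp
  qed
  then show "\<exists>no. \<forall>n\<ge>no. norm (scaled_max a n - 0) < \<eta>"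
    by (simp only: eventually_sequentially)
qed

end

section \<open>Birkhoff sums\<close>

context ergodic_invertible_system
begin

lemma integral_comp_T:
  fixes f :: "'a \<Rightarrow> real"
  assumes "integrable M f"
  shows "integrable M (\<lambda>\<omega>. f (T \<omega>))" "(\<integral>\<omega>. f (T \<omega>) \<partial>M) = (\<integral>\<omega>. f \<omega> \<partial>M)"
proof -
  have "integrable (distr M M T) f"
    using assms by (simp add: preserving)
  then show "integrable M (\<lambda>\<omega>. f (T \<omega>))"
    by (rule integrable_distr[OF measurable_T])
  show "(\<integral>\<omega>. f (T \<omega>) \<partial>M) = (\<integral>\<omega>. f \<omega> \<partial>M)"
    using integral_distr[OF measurable_T, of f] assms by (simp add: preserving)
qed

text \<open>The largest of \<open>0\<close> and the first \<open>n\<close> Birkhoff sums of \<open>f\<close>. The recursion is the form in which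
  the invariance of the measure can be applied.\<close>

fun run_max :: "('a \<Rightarrow> real) \<Rightarrow> nat \<Rightarrow> 'a \<Rightarrow> real" where
  "run_max f 0 \<omega> = 0"
| "run_max f (Suc n) \<omega> = max 0 (f \<omega> + run_max f n (T \<omega>))"

lemma run_max_nonneg: "0 \<le> run_max f n \<omega>"
  by (cases n) auto

lemma run_max_mono_Suc: "run_max f n \<omega> \<le> run_max f (Suc n) \<omega>"
proof (induction n arbitrary: \<omega>)
  case (Suc n)
  then show ?case
    unfolding run_max.simps(2)[of f n \<omega>] run_max.simps(2)[of f "Suc n" \<omega>]
    by (intro max.mono add_left_mono order_refl)
qed simp

lemma run_max_mono: "m \<le> n \<Longrightarrow> run_max f m \<omega> \<le> run_max f n \<omega>"
  by (rule lift_Suc_mono_le[of "\<lambda>n. run_max f n \<omega>"]) (rule run_max_mono_Suc)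

lemma sum_le_run_max: "(\<Sum>k<n. f ((T ^^ k) \<omega>)) \<le> run_max f n \<omega>"
proof (induction n arbitrary: \<omega>)
  case (Suc n)
  have "(\<Sum>k<Suc n. f ((T ^^ k) \<omega>)) = f \<omega> + (\<Sum>k<n. f ((T ^^ k) (T \<omega>)))"
    by (simp add: sum.lessThan_Suc_shift funpow_swap1 del: sum.lessThan_Suc)
  then show ?case using Suc[of "T \<omega>"] by simp
qed simp

lemma run_max_integrable: "integrable M f \<Longrightarrow> integrable M (run_max f n)"
proof (induction n)
  case (Suc n)
  then have "integrable M (\<lambda>\<omega>. run_max f n (T \<omega>))"
    by (intro integral_comp_T(1)) simp
  with Suc.prems have "integrable M (\<lambda>\<omega>. max 0 (f \<omega> + run_max f n (T \<omega>)))"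
    by simp
  then show ?case by simp
next
  case 0
  have "run_max f 0 = (\<lambda>\<omega>. 0)" by (rule ext) simp
  then show ?case by simp
qed

text \<open>The only ergodic input. The set where the running maxima are unbounded is invariant. If it had
  measure one, the functions \<open>run_max f (Suc n) - run_max f n \<circ> T\<close>, whose integrals are nonnegative
  because the running maxima increase and \<open>T\<close> preserves the measure, would converge to \<open>f\<close> under the
  domination by \<open>\<bar>f\<bar>\<close>; so the integral of \<open>f\<close> would be nonnegative.\<close>

lemma birkhoff_sums_bounded_above:
  fixes f :: "'a \<Rightarrow> real"
  assumes f: "integrable M f" and neg: "(\<integral>\<omega>. f \<omega> \<partial>M) < 0"
  shows "AE \<omega> in M. \<exists>B. \<forall>n. (\<Sum>k<n. f ((T ^^ k) \<omega>)) \<le> B"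
proof -
  define A where "A = {\<omega> \<in> space M. \<forall>j::nat. \<exists>n. real j < run_max f n \<omega>}"
  have meas[measurable]: "run_max f n \<in> borel_measurable M" for n
    using run_max_integrable[OF f] by (rule borel_measurable_integrable)
  have T_space: "\<omega> \<in> space M \<Longrightarrow> T \<omega> \<in> space M" for \<omega>
    using measurable_space[OF measurable_T] .
  have A[measurable]: "A \<in> sets M"
    unfolding A_def by measurable
  have "T \<omega> \<in> A \<longleftrightarrow> \<omega> \<in> A" if \<omega>: "\<omega> \<in> space M" for \<omega>
  proof
    assume *: "T \<omega> \<in> A"
    have "\<exists>n. real j < run_max f n \<omega>" for j
    proof -
      obtain n where "real (nat \<lceil>j + \<bar>f \<omega>\<bar>\<rceil>) < run_max f n (T \<omega>)"
        using * unfolding A_def by blast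
      then have "real j < run_max f (Suc n) \<omega>"
        by simp linarith
      then show ?thesis ..
    qed
    then show "\<omega> \<in> A" using \<omega> by (simp add: A_def)
  next
    assume *: "\<omega> \<in> A"
    have "\<exists>n. real j < run_max f n (T \<omega>)" for j
    proof -
      obtain n where n: "real (nat \<lceil>j + \<bar>f \<omega>\<bar>\<rceil>) < run_max f n \<omega>"
        using * unfolding A_def by blast
      then obtain m where "n = Suc m" by (cases n) auto
      with n have "real j < run_max f m (T \<omega>)"
        by (simp split: if_splits add: max_def) linarith
      then show ?thesis ..
    qed
    then show "T \<omega> \<in> A" using T_space[OF \<omega>] by (simp add: A_def)
  qed
  then have inv: "T -` A \<inter> space M = A"
    by (auto simp: A_def)
  have "prob A \<noteq> 1"
  proof
    assume "prob A = 1"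
    then have AE: "AE \<omega> in M. \<omega> \<in> A"
      using AE_in_set_eq_1[OF A] by simp
    define g where "g n \<omega> = run_max f (Suc n) \<omega> - run_max f n (T \<omega>)" for n \<omega>
    have g_eq: "g n \<omega> = max (- run_max f n (T \<omega>)) (f \<omega>)" for n \<omega>
      by (simp add: g_def max_def)
    have int_g: "0 \<le> (\<integral>\<omega>. g n \<omega> \<partial>M)" for n
    proof -
      have "(\<integral>\<omega>. g n \<omega> \<partial>M) = (\<integral>\<omega>. run_max f (Suc n) \<omega> \<partial>M) - (\<integral>\<omega>. run_max f n \<omega> \<partial>M)"
        unfolding g_def
        using integral_comp_T[OF run_max_integrable[OF f, of n]] run_max_integrable[OF f, of "Suc n"]
        by (simp del: run_max.simps)
      moreover have "(\<integral>\<omega>. run_max f n \<omega> \<partial>M) \<le> (\<integral>\<omega>. run_max f (Suc n) \<omega> \<partial>M)"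
        by (intro integral_mono run_max_integrable f run_max_mono_Suc)
      ultimately show ?thesis by simp
    qed
    have "(\<lambda>n. \<integral>\<omega>. g n \<omega> \<partial>M) \<longlonglongrightarrow> (\<integral>\<omega>. f \<omega> \<partial>M)"
    proof (rule integral_dominated_convergence[where w = "\<lambda>\<omega>. \<bar>f \<omega>\<bar>"])
      show "AE \<omega> in M. (\<lambda>n. g n \<omega>) \<longlonglongrightarrow> f \<omega>"
        using AE
      proof eventually_elim
        case (elim \<omega>)
        then have "T \<omega> \<in> A" using inv by blast
        then obtain N where "real (nat \<lceil>\<bar>f \<omega>\<bar>\<rceil>) < run_max f N (T \<omega>)"
          unfolding A_def by blast
        \<comment> \<open>The truncation from below in \<open>g_eq\<close> is inactive once the running maximum exceeds \<open>\<bar>f \<omega>\<bar>\<close>.\<close>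
        then have "g n \<omega> = f \<omega>" if "N \<le> n" for n
          using run_max_mono[OF that, of f "T \<omega>"] unfolding g_eq by linarith
        then show ?case
          by (intro tendsto_eventually) (auto simp: eventually_sequentially)
      qed
      show "AE \<omega> in M. norm (g n \<omega>) \<le> \<bar>f \<omega>\<bar>" for n
      proof (rule AE_I2)
        fix \<omega>
        show "norm (g n \<omega>) \<le> \<bar>f \<omega>\<bar>"
          using run_max_nonneg[of f n "T \<omega>"] unfolding g_eq by (simp add: max_def abs_if)
      qed
      show "g n \<in> borel_measurable M" for n
        unfolding g_def using measurable_T by measurable
    qed (use f in auto)
    then have "0 \<le> (\<integral>\<omega>. f \<omega> \<partial>M)"
      by (rule LIMSEQ_le_const) (use int_g in auto)
    with neg show False by simp
  qed
  then have "prob A = 0"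
    using ergodic[OF A inv] by blast
  then have "AE \<omega> in M. \<omega> \<notin> A"
    by (subst (asm) prob_eq_0) auto
  then show ?thesis
    using AE_space
  proof eventually_elim
    case (elim \<omega>)
    then obtain j :: nat where "\<And>n. run_max f n \<omega> \<le> real j"
      by (auto simp: A_def not_less)
    then show ?case
      using sum_le_run_max[of f \<omega>] order_trans by blast
  qed
qed

lemma inverse_system: "ergodic_invertible_system M (inv_into (space M) T)"
proof -
  let ?U = "inv_into (space M) T"
  have TU: "T (?U \<omega>) = \<omega>" and UT: "?U (T \<omega>) = \<omega>" if "\<omega> \<in> space M" for \<omega>
    using that bij_T by (auto simp: bij_betw_def f_inv_into_f)
  have T_space: "T \<omega> \<in> space M" if "\<omega> \<in> space M" for \<omega>
    using that by (rule measurable_space[OF measurable_T])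
  have bij_U: "bij_betw ?U (space M) (space M)"
    by (rule bij_betw_inv_into[OF bij_T])
  show ?thesis
  proof unfold_locales
    show "bij_betw ?U (space M) (space M)"
      by (rule bij_U)
    show "?U \<in> measurable M M"
      by (rule measurable_T_inv)
    have "inv_into (space M) ?U \<omega> = T \<omega>" if "\<omega> \<in> space M" for \<omega>
      by (rule inv_into_f_eq) (use that UT T_space bij_U in \<open>auto simp: bij_betw_def\<close>)
    then show "inv_into (space M) ?U \<in> measurable M M"
      using measurable_T by (simp cong: measurable_cong)
    have "distr M M ?U = distr (distr M M T) M ?U"
      by (simp add: preserving)
    also have "\<dots> = distr M M (?U \<circ> T)"
      by (rule distr_distr[OF measurable_T_inv measurable_T])
    also have "\<dots> = distr M M (\<lambda>\<omega>. \<omega>)"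
      by (rule distr_cong) (auto simp: UT)
    finally show "distr M M ?U = M"
      by (simp add: distr_id)
    show "prob B = 0 \<or> prob B = 1" if B: "B \<in> sets M" "?U -` B \<inter> space M = B" for B
    proof (rule ergodic[OF B(1)])
      have iff: "\<omega> \<in> B \<longleftrightarrow> T \<omega> \<in> B" if "\<omega> \<in> space M" for \<omega>
      proof -
        have "T \<omega> \<in> B \<longleftrightarrow> T \<omega> \<in> ?U -` B \<inter> space M"
          by (simp only: B(2))
        then show ?thesis
          using UT[OF that] T_space[OF that] by simp
      qed
      show "T -` B \<inter> space M = B"
      proof (intro set_eqI iffI)
        fix \<omega> assume "\<omega> \<in> B"
        moreover from this have "\<omega> \<in> space M"
          using sets.sets_into_space[OF B(1)] by (rule rev_subsetD)
        ultimately show "\<omega> \<in> T -` B \<inter> space M"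
          using iff by simp
      qed (use iff in simp)
    qed
  qed
qed

lemma birkhoff_sums_linear_upper:
  fixes f :: "'a \<Rightarrow> real"
  assumes f: "integrable M f"
  shows "AE \<omega> in M. \<exists>C. \<forall>n. (\<Sum>k<n. f ((T ^^ k) \<omega>)) \<le> C * real n"
proof -
  define m where "m = (\<integral>\<omega>. f \<omega> \<partial>M) + 1"
  have "integrable M (\<lambda>\<omega>. f \<omega> - m)" "(\<integral>\<omega>. f \<omega> - m \<partial>M) < 0"
    using f by (simp_all add: m_def prob_space)
  then have "AE \<omega> in M. \<exists>B. \<forall>n. (\<Sum>k<n. f ((T ^^ k) \<omega>) - m) \<le> B"
    by (rule birkhoff_sums_bounded_above)
  then show ?thesis
  proof eventually_elim
    case (elim \<omega>)
    then obtain B where B: "\<And>n. (\<Sum>k<n. f ((T ^^ k) \<omega>)) - m * real n \<le> B"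
      by (auto simp: sum_subtractf mult.commute)
    have "(\<Sum>k<n. f ((T ^^ k) \<omega>)) \<le> (\<bar>B\<bar> + m) * real n" for n
    proof (cases n)
      case (Suc k)
      then have "\<bar>B\<bar> * 1 \<le> \<bar>B\<bar> * real n"
        by (intro mult_left_mono) auto
      then show ?thesis
        using B[of n] by (simp add: distrib_right)
    qed simp
    then show ?case by blast
  qed
qed

text \<open>For each \<open>j\<close> some truncation of \<open>f\<close> at a constant level is integrable with integral above \<open>j\<close>;
  the sums of \<open>f\<close> dominate those of the truncation.\<close>

lemma birkhoff_sums_superlinear:
  fixes f :: "'a \<Rightarrow> real"
  assumes f[measurable]: "f \<in> borel_measurable M"
    and nonneg: "\<And>\<omega>. \<omega> \<in> space M \<Longrightarrow> 0 \<le> f \<omega>"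
    and infinite: "(\<integral>\<^sup>+ \<omega>. ennreal (f \<omega>) \<partial>M) = \<infinity>"
  shows "AE \<omega> in M. \<forall>K. \<exists>B. \<forall>n. K * real n - B \<le> (\<Sum>k<n. f ((T ^^ k) \<omega>))"
proof -
  have "AE \<omega> in M. \<exists>B. \<forall>n. real j * real n - B \<le> (\<Sum>k<n. f ((T ^^ k) \<omega>))" for j :: nat
  proof -
    define g where "g L \<omega> = min (f \<omega>) (real L)" for L \<omega>
    have g_nonneg: "\<omega> \<in> space M \<Longrightarrow> 0 \<le> g L \<omega>" for L \<omega>
      using nonneg by (simp add: g_def)
    have g_meas: "g L \<in> borel_measurable M" for L
      unfolding g_def[abs_def] by measurable
    have int_g: "integrable M (g L)" for L
      by (rule integrable_const_bound[of _ "real L"])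
        (use g_nonneg g_meas in \<open>auto simp: g_def intro!: AE_I2\<close>)
    have "(SUP L. \<integral>\<^sup>+ \<omega>. ennreal (g L \<omega>) \<partial>M) = (\<integral>\<^sup>+ \<omega>. (SUP L. ennreal (g L \<omega>)) \<partial>M)"
      by (rule nn_integral_monotone_convergence_SUP[symmetric])
        (use g_meas in \<open>auto simp: incseq_def le_fun_def g_def intro!: ennreal_leI\<close>)
    also have "\<dots> = (\<integral>\<^sup>+ \<omega>. ennreal (f \<omega>) \<partial>M)"
    proof (rule nn_integral_cong)
      fix \<omega> assume "\<omega> \<in> space M"
      obtain L :: nat where "f \<omega> \<le> real L"
        using real_arch_simple by blast
      then have "g L \<omega> = f \<omega>"
        by (simp add: g_def)
      then show "(SUP L. ennreal (g L \<omega>)) = ennreal (f \<omega>)"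
        by (intro antisym SUP_least SUP_upper2[of L]) (auto simp: g_def intro!: ennreal_leI)
    qed
    finally have "(SUP L. \<integral>\<^sup>+ \<omega>. ennreal (g L \<omega>) \<partial>M) = \<infinity>"
      by (simp only: infinite)
    then have "ennreal (real j) < (SUP L. \<integral>\<^sup>+ \<omega>. ennreal (g L \<omega>) \<partial>M)"
      by (simp only: infinity_ennreal_def ennreal_less_top)
    then obtain L where "ennreal (real j) < (\<integral>\<^sup>+ \<omega>. ennreal (g L \<omega>) \<partial>M)"
      unfolding less_SUP_iff by blast
    also have "\<dots> = ennreal (\<integral>\<omega>. g L \<omega> \<partial>M)"
      by (rule nn_integral_eq_integral[OF int_g AE_I2]) (rule g_nonneg)
    finally have "real j < (\<integral>\<omega>. g L \<omega> \<partial>M)"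
      by (simp add: ennreal_less_iff)
    then have "integrable M (\<lambda>\<omega>. real j - g L \<omega>)" "(\<integral>\<omega>. real j - g L \<omega> \<partial>M) < 0"
      using int_g by (simp_all add: prob_space)
    then have "AE \<omega> in M. \<exists>B. \<forall>n. (\<Sum>k<n. real j - g L ((T ^^ k) \<omega>)) \<le> B"
      by (rule birkhoff_sums_bounded_above)
    then show ?thesis
    proof eventually_elim
      case (elim \<omega>)
      then obtain B where B: "\<And>n. real j * real n - (\<Sum>k<n. g L ((T ^^ k) \<omega>)) \<le> B"
        by (auto simp: sum_subtractf mult.commute)
      have le: "(\<Sum>k<n. g L ((T ^^ k) \<omega>)) \<le> (\<Sum>k<n. f ((T ^^ k) \<omega>))" for n
        by (rule sum_mono) (simp add: g_def)
      have "real j * real n - B \<le> (\<Sum>k<n. f ((T ^^ k) \<omega>))" for n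
        using B[of n] le[of n] by linarith
      then show ?case by blast
    qed
  qed
  then have "AE \<omega> in M. \<forall>j::nat. \<exists>B. \<forall>n. real j * real n - B \<le> (\<Sum>k<n. f ((T ^^ k) \<omega>))"
    by (simp add: AE_all_countable)
  then show ?thesis
  proof eventually_elim
    case (elim \<omega>)
    show ?case
    proof
      fix K :: real
      obtain j :: nat where j: "K \<le> real j"
        using real_arch_simple by blast
      obtain B where B: "\<And>n. real j * real n - B \<le> (\<Sum>k<n. f ((T ^^ k) \<omega>))"
        using elim by blast
      have "K * real n - B \<le> (\<Sum>k<n. f ((T ^^ k) \<omega>))" for n
        using B[of n] mult_right_mono[OF j, of "real n"] by simp
      then show "\<exists>B. \<forall>n. K * real n - B \<le> (\<Sum>k<n. f ((T ^^ k) \<omega>))"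
        by blast
    qed
  qed
qed

lemma int_iterate_space:
  assumes "\<omega> \<in> space M"
  shows "int_iterate M T x \<omega> \<in> space M"
proof -
  have "(F ^^ k) \<omega> \<in> space M" if "F \<in> measurable M M" for F k
    using assms measurable_space[OF that] by (induction k) auto
  then show ?thesis
    using measurable_T measurable_T_inv by (simp add: int_iterate_def)
qed

end

lemma sum_int_iterate_nonneg:
  "(\<Sum>y = 0..<int R. f (int_iterate M T y \<omega>)) = (\<Sum>k<R. f ((T ^^ k) \<omega>))"
  by (rule sum.reindex_bij_witness[of _ int nat]) (auto simp: int_iterate_def)

lemma sum_int_iterate_neg:
  "(\<Sum>y = - int R..<0. f (int_iterate M T y \<omega>))
     = (\<Sum>k<R. f (inv_into (space M) T ((inv_into (space M) T ^^ k) \<omega>)))"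
proof (rule sum.reindex_bij_witness[of _ "\<lambda>k. - int (Suc k)" "\<lambda>y. nat (- y) - 1"])
  fix y assume "y \<in> {- int R..<0}"
  then have y: "\<not> 0 \<le> y" "nat (- y) = Suc (nat (- y) - 1)"
    by auto
  show "f (inv_into (space M) T ((inv_into (space M) T ^^ (nat (- y) - 1)) \<omega>)) = f (int_iterate M T y \<omega>)"
    unfolding int_iterate_def if_not_P[OF y(1)] by (subst (2) y(2)) simp
qed auto

section \<open>The law of the Markov chain\<close>

text \<open>The Markov property conditions on a full history \<open>S 0, \<dots>, S n\<close>. The early values are summed out
  one at a time, leaving a condition on the window \<open>j..n\<close>.\<close>

lemma markov_chain_window:
  assumes mc: "markov_chain P S x0 p" and "j \<le> n"
  shows "emeasure P {w \<in> space P. S (Suc n) w = y \<and> (\<forall>i. j \<le> i \<and> i \<le> n \<longrightarrow> S i w = h i)}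
       = ennreal (p (h n) y) * emeasure P {w \<in> space P. \<forall>i. j \<le> i \<and> i \<le> n \<longrightarrow> S i w = h i}"
  using \<open>j \<le> n\<close>
proof (induction j arbitrary: h)
  case 0
  interpret prob_space P using mc by (simp add: markov_chain_def)
  have [measurable]: "S n \<in> measurable P (count_space UNIV)" for n
    using mc by (simp add: markov_chain_def)
  let ?E = "{w \<in> space P. S (Suc n) w = y \<and> (\<forall>i\<le>n. S i w = h i)}"
  let ?H = "{w \<in> space P. \<forall>i\<le>n. S i w = h i}"
  have H: "?H \<in> sets P" and E: "?E \<in> sets P" by measurable
  show ?case
  proof (cases "prob ?H = 0")
    case True
    have "prob ?E \<le> prob ?H"
      by (rule finite_measure_mono) (use H in auto)
    with True have "prob ?E = 0"
      using measure_nonneg[of P ?E] by linarith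
    with True show ?thesis
      by (simp add: emeasure_eq_measure)
  next
    case False
    then have pos: "0 < prob ?H"
      using measure_nonneg[of P ?H] by linarith
    then have "\<P>(w in P. S (Suc n) w = y \<bar> \<forall>i\<le>n. S i w = h i) = p (h n) y"
      using mc by (simp add: markov_chain_def)
    then have quot: "prob ?E / prob ?H = p (h n) y"
      by (simp add: cond_prob_def)
    then have "prob ?E = p (h n) y * prob ?H"
      using pos by (simp add: field_simps)
    moreover have "0 \<le> p (h n) y"
      unfolding quot[symmetric] by simp
    ultimately show ?thesis
      by (simp add: emeasure_eq_measure ennreal_mult)
  qed
next
  case (Suc j)
  interpret prob_space P using mc by (simp add: markov_chain_def)
  have [measurable]: "S n \<in> measurable P (count_space UNIV)" for n
    using mc by (simp add: markov_chain_def)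
  have ext: "(\<forall>i. j \<le> i \<and> i \<le> n \<longrightarrow> S i w = (h(j := x)) i)
      \<longleftrightarrow> S j w = x \<and> (\<forall>i. Suc j \<le> i \<and> i \<le> n \<longrightarrow> S i w = h i)" for w x
  proof -
    have "j \<le> i \<and> i \<le> n \<longleftrightarrow> i = j \<or> Suc j \<le> i \<and> i \<le> n" for i
      using Suc.prems by linarith
    then show ?thesis
      by (simp only: fun_upd_apply) force
  qed
  let ?H = "\<lambda>x. {w \<in> space P. S j w = x \<and> (\<forall>i. Suc j \<le> i \<and> i \<le> n \<longrightarrow> S i w = h i)}"
  let ?E = "\<lambda>x. {w \<in> space P. S (Suc n) w = y \<and> S j w = x \<and> (\<forall>i. Suc j \<le> i \<and> i \<le> n \<longrightarrow> S i w = h i)}"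
  have "h n = (h(j := x)) n" for x using Suc.prems by simp
  then have step: "emeasure P (?E x) = ennreal (p (h n) y) * emeasure P (?H x)" for x
    using Suc.IH[of "h(j := x)"] Suc.prems unfolding ext by simp
  have "{w \<in> space P. S (Suc n) w = y \<and> (\<forall>i. Suc j \<le> i \<and> i \<le> n \<longrightarrow> S i w = h i)} = (\<Union>x. ?E x)"
    by auto
  then have "emeasure P {w \<in> space P. S (Suc n) w = y \<and> (\<forall>i. Suc j \<le> i \<and> i \<le> n \<longrightarrow> S i w = h i)}
      = (\<integral>\<^sup>+x. emeasure P (?E x) \<partial>count_space UNIV)"
    by (simp only:) (rule emeasure_UN_countable, auto simp: disjoint_family_on_def)
  also have "\<dots> = ennreal (p (h n) y) * (\<integral>\<^sup>+x. emeasure P (?H x) \<partial>count_space UNIV)"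
    unfolding step by (rule nn_integral_cmult) simp
  also have "(\<integral>\<^sup>+x. emeasure P (?H x) \<partial>count_space UNIV) = emeasure P (\<Union>x. ?H x)"
    by (rule emeasure_UN_countable[symmetric]) (auto simp: disjoint_family_on_def)
  also have "(\<Union>x. ?H x) = {w \<in> space P. \<forall>i. Suc j \<le> i \<and> i \<le> n \<longrightarrow> S i w = h i}"
    by auto
  finally show ?case .
qed

lemma markov_chain_one_step:
  assumes mc: "markov_chain P S x0 p"
  shows "emeasure P {w \<in> space P. S (Suc n) w = y}
       = (\<integral>\<^sup>+x. ennreal (p x y) * emeasure P {w \<in> space P. S n w = x} \<partial>count_space UNIV)"
proof -
  interpret prob_space P using mc by (simp add: markov_chain_def)
  have [measurable]: "S n \<in> measurable P (count_space UNIV)" for n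
    using mc by (simp add: markov_chain_def)
  have one: "(\<forall>i. n \<le> i \<and> i \<le> n \<longrightarrow> S i w = x) \<longleftrightarrow> S n w = x" for w x
    by auto
  have "{w \<in> space P. S (Suc n) w = y} = (\<Union>x. {w \<in> space P. S (Suc n) w = y \<and> S n w = x})"
    by auto
  then have "emeasure P {w \<in> space P. S (Suc n) w = y}
      = (\<integral>\<^sup>+x. emeasure P {w \<in> space P. S (Suc n) w = y \<and> S n w = x} \<partial>count_space UNIV)"
    by (simp only:) (rule emeasure_UN_countable, auto simp: disjoint_family_on_def)
  then show ?thesis
    using markov_chain_window[OF mc order_refl, of n y "\<lambda>_. _"] unfolding one by simp
qed

lemma markov_chain_nearest_neighbour:
  fixes p :: "int \<Rightarrow> int \<Rightarrow> real"
  assumes mc: "markov_chain P S x0 p"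
    and p0: "\<And>x. x \<noteq> y - 1 \<Longrightarrow> x \<noteq> y + 1 \<Longrightarrow> p x y = 0" and nn: "\<And>x. 0 \<le> p x y"
  shows "\<P>(w in P. S (Suc n) w = y)
       = p (y - 1) y * \<P>(w in P. S n w = y - 1) + p (y + 1) y * \<P>(w in P. S n w = y + 1)"
proof -
  interpret prob_space P using mc by (simp add: markov_chain_def)
  have "emeasure P {w \<in> space P. S (Suc n) w = y}
       = (\<integral>\<^sup>+x. ennreal (p x y) * emeasure P {w \<in> space P. S n w = x} \<partial>count_space UNIV)"
    by (rule markov_chain_one_step[OF mc])
  also have "\<dots> = (\<Sum>x\<in>{y - 1, y + 1}. ennreal (p x y) * emeasure P {w \<in> space P. S n w = x})"
    by (rule nn_integral_count_space') (use p0 in auto)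
  also have "\<dots> = ennreal (p (y - 1) y * \<P>(w in P. S n w = y - 1) + p (y + 1) y * \<P>(w in P. S n w = y + 1))"
    by (simp add: emeasure_eq_measure ennreal_mult nn ennreal_plus)
  finally show ?thesis
    by (simp add: emeasure_eq_measure nn del: ennreal_plus)
qed

context line_conductances
begin

text \<open>Reversibility turns the forward equation of the chain into the recursion defining \<open>dens\<close>.\<close>

lemma markov_chain_law:
  assumes mc: "markov_chain P S 0 p"
    and p: "\<And>x y. p x y = (if y = x + 1 then \<kappa> x else if y = x - 1 then \<kappa> y else 0) / wt x"
  shows "\<P>(w in P. S n w = x) = wt x * dens n x"
proof (induction n arbitrary: x)
  case 0
  interpret prob_space P using mc by (simp add: markov_chain_def)
  have [measurable]: "S 0 \<in> measurable P (count_space UNIV)"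
    using mc by (simp add: markov_chain_def)
  have "AE w in P. S 0 w = 0"
    using mc by (simp add: markov_chain_def)
  then have "\<P>(w in P. S 0 w = x) = prob (if x = 0 then space P else {})"
    by (intro finite_measure_eq_AE) auto
  then show ?case
    using wt_pos[of 0] by (simp add: prob_space)
next
  case (Suc n)
  have "\<P>(w in P. S (Suc n) w = x)
      = p (x - 1) x * \<P>(w in P. S n w = x - 1) + p (x + 1) x * \<P>(w in P. S n w = x + 1)"
    by (rule markov_chain_nearest_neighbour[OF mc])
      (auto simp: p less_imp_le[OF \<kappa>_pos] less_imp_le[OF wt_pos])
  also have "\<dots> = \<kappa> (x - 1) * dens n (x - 1) + \<kappa> x * dens n (x + 1)"
    using wt_pos[of "x - 1"] wt_pos[of "x + 1"] by (simp add: Suc p)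
  also have "\<dots> = wt x * dens (Suc n) x"
    by (simp add: wt_step)
  finally show ?case .
qed

end

section \<open>Almost every environment\<close>

theorem mainTheorem3:
  fixes M :: "'a measure" and T :: "'a \<Rightarrow> 'a" and c :: "'a \<Rightarrow> real"
    and P :: "'a \<Rightarrow> int \<Rightarrow> 'b measure" and S :: "nat \<Rightarrow> 'b \<Rightarrow> int"
  assumes "ergodic_invertible_system M T"
    and "c \<in> borel_measurable M"
    and "\<And>\<omega>. \<omega> \<in> space M \<Longrightarrow> 0 < c \<omega>"
    and "\<And>\<omega> x\<^sub>0. \<omega> \<in> space M \<Longrightarrow> markov_chain (P \<omega> x\<^sub>0) S x\<^sub>0 (transition_prob M T c \<omega>)"
    and "integrable M (\<lambda>\<omega>. 1 / c \<omega>)"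
  shows "(AE \<omega> in M. \<forall>a>0. bounded ((\<lambda>n::nat. sqrt (2 * real n) *
            (MAX x \<in> {x :: int. \<bar>real_of_int x\<bar> < a * sqrt (2 * real n) \<and> even x}.
               \<P>(w in P \<omega> 0. S (2 * n) w = x) / total_conductance M T c \<omega> x)) ` {1..})) \<and>
         ((\<integral>\<^sup>+ \<omega>. ennreal (total_conductance M T c \<omega> 0) \<partial>M) = \<infinity> \<longrightarrow>
          (AE \<omega> in M. \<forall>a>0. (\<lambda>n::nat. sqrt (2 * real n) *
            (MAX x \<in> {x :: int. \<bar>real_of_int x\<bar> < a * sqrt (2 * real n) \<and> even x}.
               \<P>(w in P \<omega> 0. S (2 * n) w = x) / total_conductance M T c \<omega> x)) \<longlonglongrightarrow> 0))"
proof -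
  interpret ergodic_invertible_system M T by fact
  note [measurable] = assms(2) measurable_T_inv
  let ?U = "inv_into (space M) T"
  let ?\<kappa> = "\<lambda>\<omega> x. c (int_iterate M T x \<omega>)"
  let ?F = "\<lambda>\<omega> a n. sqrt (2 * real n) *
            (MAX x \<in> {x :: int. \<bar>real_of_int x\<bar> < a * sqrt (2 * real n) \<and> even x}.
               \<P>(w in P \<omega> 0. S (2 * n) w = x) / total_conductance M T c \<omega> x)"
  interpret inv: ergodic_invertible_system M ?U
    by (rule inverse_system)
  have line: "line_conductances (?\<kappa> \<omega>)" if "\<omega> \<in> space M" for \<omega>
    by unfold_locales (rule assms(3)[OF int_iterate_space[OF that]])
  have F: "?F \<omega> a n = line_conductances.scaled_max (?\<kappa> \<omega>) a n" if \<omega>: "\<omega> \<in> space M" for \<omega> a n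
  proof -
    interpret line_conductances "?\<kappa> \<omega>" by (rule line[OF \<omega>])
    have wt: "total_conductance M T c \<omega> x = wt x" for x
      by (simp add: total_conductance_def conductance_def wt_def)
    have "\<P>(w in P \<omega> 0. S k w = x) = wt x * dens k x" for k x
      by (rule markov_chain_law[OF assms(4)[OF \<omega>]])
        (simp add: transition_prob_def conductance_def wt)
    then have "\<P>(w in P \<omega> 0. S k w = x) / total_conductance M T c \<omega> x = dens k x" for k x
      using wt_pos[of x] by (simp add: wt)
    then show ?thesis
      by (simp only: scaled_max_def)
  qed
  define G where "G \<omega> C \<longleftrightarrow> (\<forall>R. (\<Sum>y = 0..<int R. 1 / ?\<kappa> \<omega> y) \<le> C * real R)
      \<and> (\<forall>R. (\<Sum>y = - int R..<0. 1 / ?\<kappa> \<omega> y) \<le> C * real R)" for \<omega> C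
  have resistance: "AE \<omega> in M. \<exists>C. G \<omega> C"
    using birkhoff_sums_linear_upper[OF assms(5)]
      inv.birkhoff_sums_linear_upper[OF inv.integral_comp_T(1)[OF assms(5)]]
  proof eventually_elim
    case (elim \<omega>)
    obtain C1 C2 where C:
      "\<And>R. (\<Sum>k<R. 1 / c ((T ^^ k) \<omega>)) \<le> C1 * real R"
      "\<And>R. (\<Sum>k<R. 1 / c (?U ((?U ^^ k) \<omega>))) \<le> C2 * real R"
      using elim by blast
    have max: "C1 * real R \<le> max C1 C2 * real R" "C2 * real R \<le> max C1 C2 * real R" for R
      by (auto intro: mult_right_mono)
    have "G \<omega> (max C1 C2)"
      unfolding G_def sum_int_iterate_nonneg[of "\<lambda>\<omega>. 1 / c \<omega>"] sum_int_iterate_neg[of "\<lambda>\<omega>. 1 / c \<omega>"]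
      by (intro conjI allI order_trans[OF C(1) max(1)] order_trans[OF C(2) max(2)])
    then show ?case by blast
  qed
  show ?thesis
  proof (intro conjI impI)
    show "AE \<omega> in M. \<forall>a>0. bounded (?F \<omega> a ` {1..})"
      using resistance AE_space
    proof eventually_elim
      case (elim \<omega>)
      then obtain C where "G \<omega> C" by blast
      then have C: "(\<Sum>y = 0..<int R. 1 / ?\<kappa> \<omega> y) \<le> C * real R"
        "(\<Sum>y = - int R..<0. 1 / ?\<kappa> \<omega> y) \<le> C * real R" for R
        unfolding G_def by blast+
      have "bounded (line_conductances.scaled_max (?\<kappa> \<omega>) a ` {1..})" if "0 < a" for a
        by (rule line_conductances.scaled_max_bounded[OF line[OF elim(2)] C that])
      then show ?case
        by (simp only: F[OF elim(2)]) simp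
    qed
    assume inf: "(\<integral>\<^sup>+ \<omega>. ennreal (total_conductance M T c \<omega> 0) \<partial>M) = \<infinity>"
    have c_nonneg: "\<omega> \<in> space M \<Longrightarrow> 0 \<le> c \<omega>" for \<omega>
      using assms(3) by (auto intro: less_imp_le)
    have "(\<integral>\<^sup>+ \<omega>. ennreal (total_conductance M T c \<omega> 0) \<partial>M)
        = (\<integral>\<^sup>+ \<omega>. ennreal (c (?U \<omega>)) + ennreal (c \<omega>) \<partial>M)"
      by (rule nn_integral_cong)
        (auto simp: total_conductance_def conductance_def int_iterate_def c_nonneg
          measurable_space[OF measurable_T_inv] ennreal_plus)
    also have "\<dots> = (\<integral>\<^sup>+ \<omega>. ennreal (c (?U \<omega>)) \<partial>M) + (\<integral>\<^sup>+ \<omega>. ennreal (c \<omega>) \<partial>M)"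
      by (rule nn_integral_add) measurable
    also have "(\<integral>\<^sup>+ \<omega>. ennreal (c (?U \<omega>)) \<partial>M) = (\<integral>\<^sup>+ \<omega>. ennreal (c \<omega>) \<partial>distr M M ?U)"
      by (rule nn_integral_distr[symmetric]) measurable
    finally have "(\<integral>\<^sup>+ \<omega>. ennreal (c \<omega>) \<partial>M) + (\<integral>\<^sup>+ \<omega>. ennreal (c \<omega>) \<partial>M) = \<infinity>"
      by (simp only: inf inv.preserving)
    then have "(\<integral>\<^sup>+ \<omega>. ennreal (c \<omega>) \<partial>M) = \<infinity>"
      by (simp add: ennreal_add_eq_top)
    then have "AE \<omega> in M. \<forall>K. \<exists>B. \<forall>n. K * real n - B \<le> (\<Sum>k<n. c ((T ^^ k) \<omega>))"
      using c_nonneg by (intro birkhoff_sums_superlinear) auto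
    then show "AE \<omega> in M. \<forall>a>0. ?F \<omega> a \<longlonglongrightarrow> 0"
      using resistance AE_space
    proof eventually_elim
      case (elim \<omega>)
      then obtain C where "G \<omega> C" by blast
      then have C: "(\<Sum>y = 0..<int R. 1 / ?\<kappa> \<omega> y) \<le> C * real R"
        "(\<Sum>y = - int R..<0. 1 / ?\<kappa> \<omega> y) \<le> C * real R" for R
        unfolding G_def by blast+
      have "line_conductances.scaled_max (?\<kappa> \<omega>) a \<longlonglongrightarrow> 0" if "0 < a" for a
        by (rule line_conductances.scaled_max_tendsto_0[OF line[OF elim(3)] C _ that])
          (use elim(1) in \<open>simp only: sum_int_iterate_nonneg\<close>)
      then show ?case
        by (simp only: F[OF elim(3)]) simp
    qed
  qed
qed

end
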